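(* Let $p/q$ be a rational number in lowest terms such that $pq$ is even. Let $[c_0,\ldots,c_n]$ be the unique continued fraction expansion of $p/q$ in nonalternating denominator form that has a primitive block decomposition. Then the Cromwell-Murasugi index of $p/q$ equals $$1+\sum_{i}\frac{|c_i|}{2},$$ where the sum is over all $i\in\{0,\ldots,n\}$ such that $c_i$ is in an odd position in the primitive block containing it (positions within a block being numbered $1,2,3,\ldots$ from its first entry).
   Context: $[c_0,\ldots,c_n]=c_0+\cfrac{1}{c_1+\cfrac{1}{\ddots+\cfrac{1}{c_n}}}$ with integers $c_i$. It is in nonalternating denominator form if $c_1\cdots c_n\ne0$, the integers $c_1,\ldots,c_n$ all have the same sign, and $c_0$ is zero or has that same sign. Primitive blocks: a contiguous subsequence $(c_m,\ldots,c_{m+2k})$ of the partial denominators of $[c_0,\ldots,c_n]$ (with $c_1\cdots c_n\ne0$) is a primitive block if (1) $k=0$ and $c_m$ is even; or (2) $k\ge1$, all of $c_m,\ldots,c_{m+2k}$ have the same sign, $c_m$ and $c_{m+2k}$ are odd, and $c_{m+2i}$ is even for $1\le i\le k-1$; or (3) $k=0$ and $m=n$ ($c_n$ odd or even). $[c_0,\ldots,c_n]$ has a primitive block decomposition if $(c_0,\ldots,c_n)$ is a concatenation of primitive blocks. Cromwell-Murasugi index: if $pq$ is even, $p/q$ has a unique continued fraction expansion $[2d_0,2d_1,\ldots,2d_r]$ with all $d_i$ integers and $d_1\cdots d_r\ne0$. The Cromwell-Murasugi index of $p/q$ is $\sum_{i=0}^r|d_i|-t+1$, where $t$ is the number of indices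 $i$ with $d_id_{i+1}<0$. *)

theory Defs
  imports Complex_Main
begin

text \<open>
  The list \<open>[c\<^sub>0, \<dots>, c\<^sub>n]\<close> stands for the continued fraction with partial denominators
  \<open>c\<^sub>0, \<dots>, c\<^sub>n\<close>. The convention \<open>1 / 0 = 0\<close> produces no spurious expansions in the
  uses below: in the nonalternating form and in the even form every proper tail has a
  nonzero value. Both forms require the list to be nonempty.
\<close>

fun cf_value :: "int list \<Rightarrow> rat" where
  "cf_value [] = 0"
| "cf_value [c] = of_int c"
| "cf_value (c # cs) = of_int c + 1 / cf_value cs"

text \<open>For a list of length one there is no sign to compare with, so \<open>c\<^sub>0\<close> is arbitrary.\<close>

definition nonalternating :: "int list \<Rightarrow> bool" where
  "nonalternating cs \<longleftrightarrow> cs \<noteq> [] \<and>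
     ((\<forall>c\<in>set (tl cs). c > 0) \<and> hd cs \<ge> 0 \<or> (\<forall>c\<in>set (tl cs). c < 0) \<and> hd cs \<le> 0)"

definition same_sign :: "int set \<Rightarrow> bool" where
  "same_sign A \<longleftrightarrow> (\<forall>a\<in>A. a > 0) \<or> (\<forall>a\<in>A. a < 0)"

text \<open>
  \<open>primitive_block cs m k\<close>: the entries of \<open>cs\<close> at the indices \<open>m, \<dots>, m + 2 * k\<close>
  form a primitive block of \<open>cs\<close>.
\<close>

definition primitive_block :: "int list \<Rightarrow> nat \<Rightarrow> nat \<Rightarrow> bool" where
  "primitive_block cs m k \<longleftrightarrow> 0 \<notin> set (tl cs) \<and> m + 2 * k < length cs \<and>
     (k = 0 \<and> even (cs ! m) \<or>
      k \<ge> 1 \<and> same_sign ((!) cs ` {m..m + 2 * k}) \<and> odd (cs ! m) \<and> odd (cs ! (m + 2 * k)) \<and>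
        (\<forall>i\<in>{1..k - 1}. even (cs ! (m + 2 * i))) \<or>
      k = 0 \<and> m = length cs - 1)"

text \<open>The index in \<open>concat Bs\<close> of the first entry of the block \<open>Bs ! j\<close>.\<close>

definition block_start :: "int list list \<Rightarrow> nat \<Rightarrow> nat" where
  "block_start Bs j = length (concat (take j Bs))"

definition primitive_block_decomposition :: "int list \<Rightarrow> int list list \<Rightarrow> bool" where
  "primitive_block_decomposition cs Bs \<longleftrightarrow> concat Bs = cs \<and>
     (\<forall>j<length Bs. \<exists>k. length (Bs ! j) = 2 * k + 1 \<and> primitive_block cs (block_start Bs j) k)"

text \<open>Indices of \<open>concat Bs\<close> are counted from 0, but positions within a block from 1.\<close>

definition in_odd_position :: "int list list \<Rightarrow> nat \<Rightarrow> bool" where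
  "in_odd_position Bs i \<longleftrightarrow>
     (\<exists>j<length Bs. block_start Bs j \<le> i \<and> i < block_start Bs j + length (Bs ! j) \<and>
        odd (i - block_start Bs j + 1))"

definition primitive_block_expansion :: "rat \<Rightarrow> int list \<Rightarrow> bool" where
  "primitive_block_expansion x cs \<longleftrightarrow> nonalternating cs \<and> cf_value cs = x \<and>
     (\<exists>Bs. primitive_block_decomposition cs Bs)"

text \<open>\<open>even_expansion x [d\<^sub>0, \<dots>, d\<^sub>r]\<close>: the expansion of \<open>x\<close> is \<open>[2 d\<^sub>0, \<dots>, 2 d\<^sub>r]\<close>.\<close>

definition even_expansion :: "rat \<Rightarrow> int list \<Rightarrow> bool" where
  "even_expansion x ds \<longleftrightarrow> ds \<noteq> [] \<and> 0 \<notin> set (tl ds) \<and> cf_value (map (\<lambda>d. 2 * d) ds) = x"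

text \<open>
  Meaningful only when \<open>x = p / q\<close> in lowest terms with \<open>p * q\<close> even, in which case the
  even expansion exists and is unique.
\<close>

definition cromwell_murasugi_index :: "rat \<Rightarrow> int" where
  "cromwell_murasugi_index x =
     (let ds = (THE ds. even_expansion x ds)
      in (\<Sum>i<length ds. \<bar>ds ! i\<bar>)
         - int (card {i. i + 1 < length ds \<and> ds ! i * ds ! (i + 1) < 0}) + 1)"

end

theory Submission
  imports Defs
begin

text \<open>
  By symmetry let \<open>x = p / q \<ge> 0\<close>. If a block expansion of \<open>x\<close> starts with an even entry \<open>c\<close>, then
  \<open>x = c + 1 / y\<close> and the even expansion of \<open>x\<close> is that of \<open>y\<close> preceded by \<open>c\<close>, without a new sign
  change. If it starts with an odd entry, \<open>x = [c, b, d, \<dots>]\<close>, put \<open>z = [d, \<dots>]\<close>; then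
  \<open>x = (c + 1) - 1 / (2 - 1 / (2 - \<dots> - 1 / (z + 1)))\<close> with \<open>b - 1\<close> entries \<open>2\<close>. Up to signs, the even
  expansion of \<open>x\<close> is \<open>c + 1\<close>, these entries \<open>2\<close> and the even expansion of \<open>z + 1\<close>. It has \<open>b\<close> new
  sign changes, so the index of \<open>x\<close> is that of \<open>z + 1\<close> plus \<open>(c - 1) / 2\<close>. Since
  \<open>z + 1 = [d + 1, \<dots>]\<close>, an even \<open>d\<close> continues the block as an odd first entry does, and an odd \<open>d\<close>
  ends it as an even entry. Existence and uniqueness follow the same recursion, in which the
  denominators decrease and the parity of \<open>p + q\<close> is kept.
\<close>

section \<open>Continued fraction values and signs\<close>

lemma cf_value_Cons: "cf_value (c # cs) = of_int c + 1 / cf_value cs"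
  by (cases cs) auto

lemma cf_value_map_uminus: "cf_value (map uminus cs) = - cf_value cs"
  by (induction cs) (auto simp: cf_value_Cons)

lemma cf_value_pos:
  assumes "cs \<noteq> []" and "\<forall>c\<in>set cs. c > 0"
  shows "cf_value cs > 0"
  using assms
proof (induction cs)
  case (Cons c cs)
  then show ?case
    by (cases "cs = []") (auto simp: cf_value_Cons intro!: add_pos_pos)
qed simp

section \<open>Parity of numerator and denominator\<close>

definition mixed_parity :: "rat \<Rightarrow> bool" where
  "mixed_parity x \<longleftrightarrow> (\<exists>p q :: int. q \<noteq> 0 \<and> odd (p + q) \<and> x = of_int p / of_int q)"

text \<open>Serves to exclude a last block that is a single odd entry: \<open>p = c * q\<close>
  would make \<open>p + q\<close> even.\<close>

lemma not_mixed_parity_odd: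
  assumes "odd c"
  shows "\<not> mixed_parity (of_int c)"
proof
  assume "mixed_parity (of_int c)"
  then obtain p q :: int where pq: "q \<noteq> 0" "odd (p + q)" "(of_int c :: rat) = of_int p / of_int q"
    unfolding mixed_parity_def by blast
  then have "(of_int (c * q) :: rat) = of_int p"
    by (simp add: field_simps)
  then have "p = c * q"
    by (simp only: of_int_eq_iff)
  then show False using pq(2) assms by auto
qed

lemma mixed_parity_even_step:
  assumes "mixed_parity (of_int c + 1 / y)" and "even c" and "y \<noteq> 0"
  shows "mixed_parity y"
proof -
  obtain p q :: int where pq: "q \<noteq> 0" "odd (p + q)" "of_int c + 1 / y = of_int p / of_int q"
    using assms(1) unfolding mixed_parity_def by blast
  then have e: "1 / y = of_int (p - c * q) / of_int q"
    by (simp add: field_simps)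
  then have "p - c * q \<noteq> 0" using assms(3) by auto
  moreover have "y = of_int q / of_int (p - c * q)"
    using arg_cong[OF e, of inverse] by simp
  moreover have "odd (q + (p - c * q))" using pq(2) assms(2) by auto
  ultimately show ?thesis unfolding mixed_parity_def by blast
qed

text \<open>Two steps of Euclid's algorithm give \<open>z = r / u\<close>, hence
  \<open>z + 1 = (r + u) / u\<close>. The sum \<open>r + 2 * u\<close> has the parity of
  \<open>r = p - c * q\<close>, which for odd \<open>c\<close> is that of \<open>p + q\<close>,
  whatever the parity of \<open>b\<close>.\<close>

lemma mixed_parity_odd_step:
  assumes "mixed_parity (of_int c + 1 / (of_int b + 1 / z))" and "odd c" and "b > 0" and "z > 0"
  shows "mixed_parity (z + 1)"
proof -
  define y where "y = of_int b + 1 / z"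
  have y: "y > 0" using assms by (auto simp: y_def intro!: add_pos_pos)
  obtain p q :: int where pq: "q \<noteq> 0" "odd (p + q)" "of_int c + 1 / y = of_int p / of_int q"
    using assms(1) unfolding mixed_parity_def y_def by blast
  define r where "r = p - c * q"
  define u where "u = q - b * r"
  have e: "1 / y = of_int r / of_int q"
    using pq by (simp add: field_simps r_def)
  have r: "r \<noteq> 0" using e y by auto
  have yq: "y * of_int r = of_int q" using e y pq(1) by (simp add: field_simps)
  have zu: "z * of_int u = of_int r"
  proof -
    have "z * of_int u = z * (y - of_int b) * of_int r"
      by (simp add: u_def algebra_simps flip: yq)
    also have "z * (y - of_int b) = 1" using assms(4) by (simp add: y_def)
    finally show ?thesis by simp
  qed
  have u: "u \<noteq> 0" using zu r by auto
  have "z + 1 = of_int (r + u) / of_int u" using zu u by (simp add: field_simps)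
  moreover have "odd (r + u + u)" using pq(2) assms(2) by (auto simp: r_def)
  ultimately show ?thesis using u unfolding mixed_parity_def by blast
qed

section \<open>Block chains: floor, uniqueness, existence\<close>

text \<open>
  \<open>block_chain cs s\<close>: \<open>cs\<close> is a nonnegative concatenation of primitive blocks other than a final odd
  entry, and \<open>s\<close> is half the sum of the entries in odd positions. In the odd case the first two
  entries of a block are removed and the third is incremented, which gives a block again.
\<close>

inductive block_chain :: "int list \<Rightarrow> rat \<Rightarrow> bool" where
  last: "even c \<Longrightarrow> 0 \<le> c \<Longrightarrow> block_chain [c] (of_int c / 2)"
| even: "even c \<Longrightarrow> 0 \<le> c \<Longrightarrow> block_chain cs s \<Longrightarrow> hd cs > 0 \<Longrightarrow>
    block_chain (c # cs) (of_int c / 2 + s)"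
| odd: "odd c \<Longrightarrow> 0 < c \<Longrightarrow> 0 < b \<Longrightarrow> 0 < d \<Longrightarrow> block_chain ((d + 1) # cs) s \<Longrightarrow>
    block_chain (c # b # d # cs) ((of_int c - 1) / 2 + s)"

text \<open>A chain that starts with 1 has at least three entries, since a single entry is even. So
  the remainder after an even entry has value above 1, and its reciprocal never reaches 1.\<close>

lemma block_chain_value:
  assumes "block_chain cs s"
  shows "cs \<noteq> [] \<and> of_int (hd cs) \<le> cf_value cs \<and> cf_value cs < of_int (hd cs) + 1 \<and>
    (tl cs \<noteq> [] \<longrightarrow> of_int (hd cs) < cf_value cs)"
  using assms
proof induction
  case (last c)
  then show ?case by simp
next
  case (even c cs s)
  have "cf_value cs > 1"
  proof (cases "hd cs = 1")
    case True
    have "tl cs \<noteq> []"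
      using even.hyps(3) True by (cases rule: block_chain.cases) auto
    then show ?thesis using even.IH True by auto
  next
    case False
    then have "of_int (hd cs) \<ge> (2 :: rat)" using even.hyps(4) by simp
    then show ?thesis using even.IH by linarith
  qed
  then show ?case by (simp add: cf_value_Cons)
next
  case (odd c b d cs s)
  define z where "z = cf_value (d # cs)"
  have "cf_value ((d + 1) # cs) = z + 1" by (simp add: cf_value_Cons z_def)
  then have "z \<ge> of_int d" using odd.IH by simp
  then have z: "z \<ge> 1" using odd.hyps by (metis int_one_le_iff_zero_less of_int_1_le_iff order_trans)
  then have "1 / z > 0" by simp
  moreover have "of_int b \<ge> (1 :: rat)" using odd.hyps by simp
  ultimately have "of_int b + 1 / z > 1" by linarith
  then show ?case by (simp add: cf_value_Cons z_def)
qed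

lemma block_chain_odd_tail_ge_1:
  assumes "block_chain ((d + 1) # cs) s" and "0 < d"
  shows "cf_value (d # cs) \<ge> 1"
proof -
  have "cf_value ((d + 1) # cs) = cf_value (d # cs) + 1" by (simp add: cf_value_Cons)
  then have "cf_value (d # cs) \<ge> of_int d" using block_chain_value[OF assms(1)] by simp
  then show ?thesis using assms(2) by (metis int_one_le_iff_zero_less of_int_1_le_iff order_trans)
qed

lemma block_chain_floor: "block_chain cs s \<Longrightarrow> \<lfloor>cf_value cs\<rfloor> = hd cs"
  using block_chain_value by (auto simp: floor_eq_iff)

text \<open>The first entry is the floor of the value and its parity selects the rule; an even entry
  is the last one exactly if the value is an integer. The induction then descends to the remainder
  that the rule leaves.\<close>

lemma block_chain_unique:
  assumes "block_chain cs s" and "block_chain cs' s'" and "cf_value cs' = cf_value cs"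
  shows "cs' = cs"
  using assms
proof (induction arbitrary: cs' s')
  case (last c)
  then have "hd cs' = c" using block_chain_floor by fastforce
  moreover from last have "tl cs' = []" using block_chain_value[of cs' s'] \<open>hd cs' = c\<close> by auto
  ultimately show ?case using block_chain_value[OF last.prems(1)] by (cases cs') auto
next
  case (even c cs s)
  have ch: "block_chain (c # cs) (of_int c / 2 + s)" using even.hyps by (rule block_chain.even)
  have h: "hd cs' = c" using block_chain_floor[OF ch] block_chain_floor[OF even.prems(1)] even.prems(2) by simp
  have ne: "tl cs' \<noteq> []"
  proof
    assume "tl cs' = []"
    then have "cs' = [c]" using h block_chain_value[OF even.prems(1)] by (cases cs') auto
    then show False using even.prems(2) block_chain_value[OF ch] block_chain_value[OF even.hyps(3)] by simp
  qed
  from even.prems(1) show ?case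
  proof cases
    case (even c' ds t)
    then have "cf_value ds = cf_value cs" using even.prems(2) h local.even by (simp add: cf_value_Cons)
    then show ?thesis using even.IH[of ds t] h local.even by simp
  qed (use ne h even.hyps in auto)
next
  case (odd c b d cs s)
  have ch: "block_chain (c # b # d # cs) ((of_int c - 1) / 2 + s)" using odd.hyps by (rule block_chain.odd)
  have h: "hd cs' = c" using block_chain_floor[OF ch] block_chain_floor[OF odd.prems(1)] odd.prems(2) by simp
  from odd.prems(1) show ?case
  proof cases
    case (odd c' b' d' ds t)
    define z where "z = cf_value (d # cs)"
    define z' where "z' = cf_value (d' # ds)"
    have z: "z \<ge> 1" using block_chain_odd_tail_ge_1 \<open>block_chain ((d + 1) # cs) s\<close> \<open>0 < d\<close> z_def by simp
    have z': "z' \<ge> 1" using block_chain_odd_tail_ge_1 odd z'_def by simp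
    have e: "of_int b + 1 / z = of_int b' + 1 / z'"
      using odd.prems(2) h odd by (simp add: cf_value_Cons z_def z'_def)
    \<comment> \<open>Since \<open>z = 1\<close> is possible, \<open>b\<close> need not be the floor
      of \<open>b + 1 / z\<close>; with \<open>1 / z\<close> in \<open>(0, 1]\<close> it is the
      ceiling minus one.\<close>
    have "1 / z > 0" "1 / z \<le> 1" "1 / z' > 0" "1 / z' \<le> 1" using z z' by auto
    then have "of_int b < (of_int (b' + 1) :: rat)" "of_int b' < (of_int (b + 1) :: rat)"
      using e by (simp_all, linarith+)
    then have b: "b = b'" unfolding of_int_less_iff by simp
    then have "cf_value ((d' + 1) # ds) = cf_value ((d + 1) # cs)"
      using e by (simp add: cf_value_Cons z_def z'_def)
    then have "(d' + 1) # ds = (d + 1) # cs" using odd.IH odd by blast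
    then show ?thesis using b h odd by simp
  qed (use h odd.hyps in auto)
qed

text \<open>Euclid's algorithm in steps that keep the parity of numerator plus denominator: an even
  quotient leads to \<open>q / r\<close>, an odd one to \<open>(r + u) / u\<close>, both with a
  smaller denominator.\<close>

lemma block_chain_exists:
  fixes p q :: int
  assumes "p \<ge> 0" and "q > 0" and "odd (p + q)"
  shows "\<exists>cs s. block_chain cs s \<and> cf_value cs = of_int p / of_int q"
  using assms
proof (induction "nat q" arbitrary: p q rule: less_induct)
  case less
  define c where "c = p div q"
  define r where "r = p mod q"
  have p: "p = c * q + r" by (simp add: c_def r_def)
  have c: "c \<ge> 0" using less.prems by (simp add: c_def pos_imp_zdiv_nonneg_iff)
  have r: "0 \<le> r" "r < q" using less.prems by (auto simp: r_def)
  have x: "of_int p / of_int q = of_int c + (of_int r / of_int q :: rat)"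
    using less.prems by (simp add: p field_simps)
  show ?case
  proof (cases "r = 0")
    case True
    \<comment> \<open>Here \<open>p + q = (c + 1) * q\<close> is odd.\<close>
    then have "even c" using less.prems p by auto
    then have "block_chain [c] (of_int c / 2)" using c by (rule block_chain.last)
    then show ?thesis using x True by force
  next
    case False
    then have r0: "r > 0" using r by simp
    show ?thesis
    proof (cases "even c")
      case True
      have "odd (q + r)" using less.prems True by (auto simp: p)
      then obtain cs s where cs: "block_chain cs s" "cf_value cs = of_int q / of_int r"
        using less.hyps[of r q] r r0 by auto
      have "hd cs > 0"
        using block_chain_floor[OF cs(1)] cs(2) r r0 pos_imp_zdiv_pos_iff[of r q]
        by (simp add: floor_divide_of_int_eq)
      then have "block_chain (c # cs) (of_int c / 2 + s)" using True c cs by (intro block_chain.even)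
      moreover have "cf_value (c # cs) = of_int p / of_int q" by (simp add: cf_value_Cons cs x)
      ultimately show ?thesis by blast
    next
      case False
      text \<open>This \<open>b\<close> is \<open>\<lceil>q / r\<rceil> - 1\<close>: an integer \<open>q / r\<close> is to be expanded as \<open>[b, 1]\<close>.\<close>
      define b where "b = (q - 1) div r"
      define u where "u = q - b * r"
      have b: "b > 0" using r r0 by (simp add: b_def pos_imp_zdiv_pos_iff)
      have "u = 1 + (q - 1) mod r" by (simp add: u_def b_def minus_div_mult_eq_mod [symmetric])
      then have u: "u > 0" "u \<le> r"
        using pos_mod_sign[of r "q - 1"] pos_mod_bound[of r "q - 1"] r0 by linarith+
      have "odd (r + u + u)" using less.prems False by (auto simp: p)
      then obtain cs s where cs: "block_chain cs s" "cf_value cs = of_int (r + u) / of_int u"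
        using less.hyps[of u "r + u"] r u by auto
      have "hd cs = (r + u) div u" using block_chain_floor[OF cs(1)] cs(2) floor_divide_of_int_eq by metis
      also have "\<dots> = r div u + 1" using u by simp
      finally have hd: "hd cs > 1" using u pos_imp_zdiv_pos_iff[of u r] by linarith
      \<comment> \<open>As \<open>u \<le> r\<close>, the chain for \<open>(r + u) / u\<close> starts
        with at least 2, and lowering this entry by one leaves it positive.\<close>
      define d where "d = hd cs - 1"
      have csd: "cs = (d + 1) # tl cs" using block_chain_value[OF cs(1)] by (simp add: d_def)
      have ch: "block_chain (c # b # d # tl cs) ((of_int c - 1) / 2 + s)"
      proof (rule block_chain.odd)
        show "c > 0" using c False by (cases "c = 0") auto
        show "d > 0" using hd by (simp add: d_def)
        show "block_chain ((d + 1) # tl cs) s" using cs csd by simp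
      qed (use False b in auto)
      have "cf_value cs = cf_value (d # tl cs) + 1" by (subst csd) (simp add: cf_value_Cons)
      then have "cf_value (d # tl cs) = of_int r / of_int u"
        using u by (simp add: cs field_simps)
      then have "cf_value (b # d # tl cs) = of_int b + of_int u / of_int r"
        by (subst cf_value_Cons) simp
      also have "\<dots> = of_int q / of_int r" using r0 by (simp add: u_def field_simps)
      finally have "cf_value (c # b # d # tl cs) = of_int p / of_int q"
        by (subst cf_value_Cons) (simp add: x)
      then show ?thesis using ch by blast
    qed
  qed
qed

section \<open>Even expansions and their index\<close>

text \<open>The index less its constant 1, taken of the expansion itself so that no definite
  description enters the inductions.\<close>

definition cm_sum :: "int list \<Rightarrow> int" where
  "cm_sum ds = (\<Sum>i<length ds. \<bar>ds ! i\<bar>)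
     - int (card {i. i + 1 < length ds \<and> ds ! i * ds ! (i + 1) < 0})"

lemma cm_sum_single: "cm_sum [d] = \<bar>d\<bar>"
  by (simp add: cm_sum_def)

lemma cm_sum_Cons:
  assumes "ds \<noteq> []"
  shows "cm_sum (d # ds) = \<bar>d\<bar> - (if d * hd ds < 0 then 1 else 0) + cm_sum ds"
proof -
  let ?A = "\<lambda>ds :: int list. {i. i + 1 < length ds \<and> ds ! i * ds ! (i + 1) < 0}"
  have "?A (d # ds) = (if d * hd ds < 0 then {0} else {}) \<union> Suc ` ?A ds"
  proof (rule set_eqI)
    fix i show "i \<in> ?A (d # ds) \<longleftrightarrow> i \<in> (if d * hd ds < 0 then {0} else {}) \<union> Suc ` ?A ds"
      using assms by (cases i) (auto simp: hd_conv_nth)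
  qed
  moreover have "finite (?A ds)" by (rule finite_subset[of _ "{..<length ds}"]) auto
  ultimately have "card (?A (d # ds)) = (if d * hd ds < 0 then 1 else 0) + card (?A ds)"
    by (auto simp: card_image card_insert_if)
  moreover have "(\<Sum>i<length (d # ds). \<bar>(d # ds) ! i\<bar>) = \<bar>d\<bar> + (\<Sum>i<length ds. \<bar>ds ! i\<bar>)"
    by (simp only: list.size(4) add_0_right add_Suc_right sum.lessThan_Suc_shift) simp
  ultimately show ?thesis unfolding cm_sum_def by auto
qed

lemma cm_sum_map_uminus: "cm_sum (map uminus ds) = cm_sum ds"
proof (induction ds)
  case (Cons d ds)
  then show ?case by (cases "ds = []") (auto simp: cm_sum_single cm_sum_Cons hd_map)
qed simp

lemma cf_value_double_uminus:
  "cf_value (map (\<lambda>d. 2 * d) (map uminus ds)) = - cf_value (map (\<lambda>d. 2 * d) ds)"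
  using cf_value_map_uminus[of "map (\<lambda>d. 2 * d) ds"] by (simp add: comp_def)

lemma even_expansion_uminus:
  assumes "even_expansion x ds"
  shows "even_expansion (- x) (map uminus ds)"
  using assms cf_value_double_uminus[of ds] unfolding even_expansion_def
  by (auto simp: map_tl[symmetric])

text \<open>The head of \<open>ds\<close> moves into the tail of the new list, where zeros are
  forbidden.\<close>

lemma even_expansion_Cons:
  assumes "even_expansion y ds" and "hd ds \<noteq> 0"
  shows "even_expansion (of_int (2 * d) + 1 / y) (d # ds)"
  using assms unfolding even_expansion_def
  by (cases ds) (auto simp: cf_value_Cons)

text \<open>Each doubled entry has modulus at least 2 and the reciprocal of the tail has modulus
  below 1, also for an empty tail because \<open>1 / 0 = 0\<close>.\<close>

lemma abs_even_value_gt_1: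
  assumes "ds \<noteq> []" and "0 \<notin> set ds"
  shows "\<bar>cf_value (map (\<lambda>d. 2 * d) ds)\<bar> > 1"
  using assms
proof (induction ds)
  case (Cons d ds)
  let ?v = "cf_value (map (\<lambda>d. 2 * d) ds)"
  have d: "\<bar>of_int (2 * d) :: rat\<bar> \<ge> 2"
  proof -
    have "2 \<le> \<bar>2 * d\<bar>" using Cons.prems(2) by auto
    then have "of_int 2 \<le> (of_int \<bar>2 * d\<bar> :: rat)" by (simp only: of_int_le_iff)
    then show ?thesis by simp
  qed
  have "\<bar>1 / ?v\<bar> < 1"
    using Cons by (cases "ds = []") auto
  with d have "\<bar>of_int (2 * d) + 1 / ?v\<bar> > 1" by linarith
  then show ?case by (simp add: cf_value_Cons)
qed simp

text \<open>The reciprocals of the tails have modulus below 1, so the even first terms differ by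
  less than 2 and therefore agree.\<close>

lemma even_value_inj:
  assumes "ds \<noteq> []" and "es \<noteq> []" and "0 \<notin> set (tl ds)" and "0 \<notin> set (tl es)"
    and "cf_value (map (\<lambda>d. 2 * d) ds) = cf_value (map (\<lambda>d. 2 * d) es)"
  shows "ds = es"
  using assms
proof (induction ds arbitrary: es)
  case (Cons d ds)
  obtain e es' where es: "es = e # es'" using Cons.prems by (cases es) auto
  let ?v = "cf_value (map (\<lambda>d. 2 * d) ds)" and ?w = "cf_value (map (\<lambda>d. 2 * d) es')"
  have small: "\<bar>1 / cf_value (map (\<lambda>d. 2 * d) fs)\<bar> < 1" if "0 \<notin> set fs" for fs
    using abs_even_value_gt_1[OF _ that] by (cases "fs = []") auto
  have v: "\<bar>1 / ?v\<bar> < 1" and w: "\<bar>1 / ?w\<bar> < 1" using small Cons.prems es by auto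
  have eq: "of_int (2 * d) + 1 / ?v = of_int (2 * e) + 1 / ?w"
    using Cons.prems es by (simp add: cf_value_Cons)
  have "\<bar>of_int (2 * d) - of_int (2 * e) :: rat\<bar> < 2" using eq v w by linarith
  then have "\<bar>of_int (2 * d - 2 * e) :: rat\<bar> < of_int 2" by simp
  then have "\<bar>2 * d - 2 * e\<bar> < 2" by (simp only: of_int_less_iff flip: of_int_abs)
  then have de: "d = e" by simp
  then have vw: "?v = ?w" using eq by simp
  \<comment> \<open>An empty tail has value 0, a nonempty one a value of modulus above 1, so both
    tails are empty or neither is.\<close>
  have "ds = es'"
  proof (cases "ds = [] \<or> es' = []")
    case True
    moreover have "?v \<noteq> 0 \<and> es' = []" if "ds \<noteq> []" using abs_even_value_gt_1[of ds] Cons.prems that True by auto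
    moreover have "?w \<noteq> 0 \<and> ds = []" if "es' \<noteq> []" using abs_even_value_gt_1[of es'] Cons.prems es that True by auto
    ultimately show ?thesis using vw by (cases "ds = []"; cases "es' = []") auto
  next
    case False
    then show ?thesis using Cons.IH[of es'] Cons.prems es vw by (auto dest: list.set_sel(2))
  qed
  then show ?case using de es by simp
qed simp

lemma cromwell_murasugi_index_eq:
  assumes "even_expansion x ds"
  shows "cromwell_murasugi_index x = cm_sum ds + 1"
proof -
  have "(THE ds. even_expansion x ds) = ds"
    using assms even_value_inj by (intro the_equality) (auto simp: even_expansion_def)
  then show ?thesis by (simp add: cromwell_murasugi_index_def cm_sum_def)
qed

section \<open>Even expansions of block chains\<close>

text \<open>
  An entry \<open>b = n + 1\<close> in an even position of a block becomes a run of \<open>n\<close> entries \<open>\<plusminus> 2\<close> with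
  alternating signs, since the values \<open>g\<^sub>n\<close> below satisfy \<open>g\<^sub>n\<^sub>+\<^sub>1 = 2 - 1 / g\<^sub>n\<close>;
  each such entry is compensated by the sign change it causes.
\<close>

lemma even_expansion_twos:
  fixes z :: rat
  assumes "z > 0" and "even_expansion (z + 1) ds" and "hd ds > 0"
  shows "\<exists>es. even_expansion ((of_nat (n + 1) * z + 1) / (of_nat n * z + 1)) es \<and>
    hd es > 0 \<and> cm_sum es = cm_sum ds"
proof (induction n)
  case 0
  then show ?case using assms by auto
next
  case (Suc n)
  let ?g = "(of_nat (n + 1) * z + 1) / (of_nat n * z + 1)"
  obtain es where es: "even_expansion ?g es" "hd es > 0" "cm_sum es = cm_sum ds"
    using Suc by blast
  have ne: "es \<noteq> []" using es by (simp add: even_expansion_def)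
  \<comment> \<open>Writing \<open>2 - 1 / ?g\<close> as \<open>2 + 1 / (- ?g)\<close> brings in the
    previous expansion with all signs reversed.\<close>
  have "even_expansion (of_int (2 * 1) + 1 / (- ?g)) (1 # map uminus es)"
    using es ne by (intro even_expansion_Cons even_expansion_uminus) (auto simp: hd_map)
  moreover have "of_int (2 * 1) + 1 / (- ?g) = (of_nat (Suc n + 1) * z + 1) / (of_nat (Suc n) * z + 1)"
  proof -
    have "of_nat n * z \<ge> 0" using assms by simp
    then have "of_nat n * z + 1 > 0" "of_nat n * z + z + 1 > 0" using assms by linarith+
    then show ?thesis by (simp add: field_simps)
  qed
  moreover have "cm_sum (1 # map uminus es) = cm_sum es"
    using ne es by (simp add: cm_sum_Cons cm_sum_map_uminus hd_map)
  ultimately show ?case using es by (metis list.sel(1) zero_less_one)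
qed

text \<open>The clauses on \<open>hd ds\<close> control the sign change at the joint: an even first
  entry creates none, an odd one exactly one, because the rest enters negated.\<close>

lemma block_chain_even_expansion:
  assumes "block_chain cs s"
  shows "\<exists>ds. even_expansion (cf_value cs) ds \<and> of_int (cm_sum ds) = s \<and>
    0 \<le> hd ds \<and> (0 < hd cs \<longrightarrow> 0 < hd ds)"
  using assms
proof induction
  case (last c)
  then have "even_expansion (cf_value [c]) [c div 2] \<and> of_int (cm_sum [c div 2]) = (of_int c / 2 :: rat)"
    by (auto simp: even_expansion_def cm_sum_single elim!: evenE)
  moreover have "0 < c \<longrightarrow> 0 < c div 2" using last by (auto elim!: evenE)
  ultimately show ?case using last by (intro exI[of _ "[c div 2]"]) simp
next
  case (even c cs s)
  then obtain ds where ds: "even_expansion (cf_value cs) ds" "of_int (cm_sum ds) = s" "0 < hd ds"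
    by blast
  obtain a where a: "c = 2 * a" "a \<ge> 0" using even.hyps by (auto elim!: evenE)
  have ne: "ds \<noteq> []" using ds by (simp add: even_expansion_def)
  have "even_expansion (cf_value (c # cs)) (a # ds)"
    using even_expansion_Cons[OF ds(1), of a] ds a by (simp add: cf_value_Cons)
  moreover have "of_int (cm_sum (a # ds)) = of_int c / 2 + s"
    using ne ds a mult_nonneg_nonneg[of a "hd ds"] by (simp add: cm_sum_Cons not_less)
  ultimately show ?case using a by (intro exI[of _ "a # ds"]) auto
next
  case (odd c b d cs s)
  define z where "z = cf_value (d # cs)"
  have z: "z \<ge> 1" using block_chain_odd_tail_ge_1 odd z_def by simp
  have z1: "cf_value ((d + 1) # cs) = z + 1" by (simp add: cf_value_Cons z_def)
  obtain ds where ds: "even_expansion (z + 1) ds" "of_int (cm_sum ds) = s" "0 < hd ds"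
    using odd.IH odd.hyps z1 by auto
  define n where "n = nat (b - 1)"
  have bn: "of_int b = (of_nat n + 1 :: rat)" using odd.hyps by (simp add: n_def)
  let ?g = "(of_nat (n + 1) * z + 1) / (of_nat n * z + 1)"
  obtain es where es: "even_expansion ?g es" "hd es > 0" "cm_sum es = cm_sum ds"
    using even_expansion_twos[of z ds n] z ds by auto
  obtain a where a: "c = 2 * a + 1" "a \<ge> 0" using odd.hyps by (auto elim!: oddE)
  have ne: "es \<noteq> []" using es by (simp add: even_expansion_def)
  have "even_expansion (of_int (2 * (a + 1)) + 1 / (- ?g)) ((a + 1) # map uminus es)"
    using es ne by (intro even_expansion_Cons even_expansion_uminus) (auto simp: hd_map)
  \<comment> \<open>With \<open>b = n + 1\<close>, \<open>1 / (b + 1 / z) = z / (b * z + 1) = 1 - (n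
    * z + 1) / (b * z + 1)\<close>, and the last fraction is \<open>1 / ?g\<close>.\<close>
  moreover have "of_int (2 * (a + 1)) + 1 / (- ?g) = cf_value (c # b # d # cs)"
  proof -
    have "of_nat n * z \<ge> 0" using z by simp
    then have "of_nat n * z + 1 > 0" "of_nat n * z + z + 1 > 0" using z by linarith+
    moreover have "cf_value (c # b # d # cs) = of_int c + 1 / (of_int b + 1 / z)"
      unfolding z_def by (subst cf_value_Cons, subst cf_value_Cons) simp
    moreover have "of_int b + 1 / z = (of_nat n * z + z + 1) / z"
      using z by (simp add: bn field_simps)
    ultimately show ?thesis using a(1) by (simp add: field_simps)
  qed
  \<comment> \<open>The first entry contributes \<open>a + 1\<close> less one sign change, which is
    \<open>a = (c - 1) / 2\<close>.\<close>
  moreover have "of_int (cm_sum ((a + 1) # map uminus es)) = (of_int c - 1) / 2 + s"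
    using ne es ds a mult_pos_pos[of "a + 1" "hd es"]
    by (simp add: cm_sum_Cons cm_sum_map_uminus hd_map algebra_simps)
  ultimately have "even_expansion (cf_value (c # b # d # cs)) ((a + 1) # map uminus es) \<and>
    of_int (cm_sum ((a + 1) # map uminus es)) = (of_int c - 1) / 2 + s"
    by metis
  then show ?case using a by (intro exI[of _ "(a + 1) # map uminus es"]) simp
qed

section \<open>Recursive form of a single block\<close>

text \<open>Mirrors \<open>block_chain\<close> inside one block. Incrementing the third entry flips
  its parity: an even inner entry becomes the odd start of a shorter block, an odd final entry
  becomes a block of one even entry.\<close>

inductive positive_block :: "int list \<Rightarrow> bool" where
  even: "even c \<Longrightarrow> 0 \<le> c \<Longrightarrow> positive_block [c]"
| odd: "odd c \<Longrightarrow> 0 < c \<Longrightarrow> 0 < b \<Longrightarrow> 0 < d \<Longrightarrow> positive_block ((d + 1) # B) \<Longrightarrow>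
    positive_block (c # b # d # B)"

text \<open>Here \<open>k\<close> counts the inner entries in odd positions, one fewer than the
  parameter of \<open>primitive_block\<close>; the base case is a block of three entries.\<close>

lemma positive_blockI:
  assumes "length B = 2 * k + 3" and "\<forall>c\<in>set B. c > 0" and "odd (B ! 0)" and "odd (B ! (2 * k + 2))"
    and "\<forall>i\<in>{1..k}. even (B ! (2 * i))"
  shows "positive_block B"
  using assms
proof (induction k arbitrary: B)
  case 0
  then obtain c b d where "B = [c, b, d]" by (auto simp: length_Suc_conv numeral_eq_Suc)
  then show ?case using 0 by (auto intro!: positive_block.intros)
next
  case (Suc k)
  then obtain c b d C where B: "B = c # b # d # C" by (auto simp: length_Suc_conv numeral_eq_Suc)
  have ev: "even (B ! (2 * i))" if "1 \<le> i" "i \<le> Suc k" for i using Suc.prems(5) that by auto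
  have "positive_block ((d + 1) # C)"
  proof (rule Suc.IH)
    show "odd (((d + 1) # C) ! 0)" using ev[of 1] by (simp add: B)
    show "\<forall>i\<in>{1..k}. even (((d + 1) # C) ! (2 * i))"
    proof
      fix i assume "i \<in> {1..k}"
      then show "even (((d + 1) # C) ! (2 * i))" using ev[of "Suc i"] by (cases i) (auto simp: B)
    qed
  qed (use Suc.prems B in auto)
  then show ?case using Suc.prems by (auto simp: B intro!: positive_block.odd)
qed

lemma positive_blockD:
  assumes "positive_block B"
  shows "\<exists>k. length B = 2 * k + 1 \<and> (k = 0 \<and> even (B ! 0) \<or>
      k \<ge> 1 \<and> (\<forall>c\<in>set B. c > 0) \<and> odd (B ! 0) \<and> odd (B ! (2 * k)) \<and>
      (\<forall>i\<in>{1..k - 1}. even (B ! (2 * i))))"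
  using assms
proof induction
  case (even c)
  then show ?case by auto
next
  case (odd c b d B)
  then obtain k where k: "length ((d + 1) # B) = 2 * k + 1"
    "k = 0 \<and> odd d \<or> k \<ge> 1 \<and> (\<forall>c\<in>set B. c > 0) \<and> even d \<and> odd (((d + 1) # B) ! (2 * k)) \<and>
      (\<forall>i\<in>{1..k - 1}. even (((d + 1) # B) ! (2 * i)))"
    by auto
  \<comment> \<open>The shift by two fails only at \<open>i = 0\<close>, where \<open>d\<close>
    faces \<open>d + 1\<close>; that entry is treated separately below.\<close>
  have nth: "(c # b # d # B) ! (2 * Suc i) = ((d + 1) # B) ! (2 * i)" if "i > 0" for i
    using that by (cases i) auto
  have "even ((c # b # d # B) ! (2 * i))" if "i \<in> {1..k}" for i
  proof (cases "i = 1")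
    case True
    then show ?thesis using that k(2) by (simp add: numeral_2_eq_2)
  next
    case False
    define j where "j = i - 1"
    then have j: "i = Suc j" "j \<in> {1..k - 1}" using that False by auto
    then have "even (((d + 1) # B) ! (2 * j))" using k(2) by auto
    then show ?thesis using nth[of j] j by simp
  qed
  moreover have "odd ((c # b # d # B) ! (2 * Suc k))"
    using k(2) nth[of k] by (cases "k = 0") auto
  ultimately show ?case using odd.hyps k by (intro exI[of _ "Suc k"]) auto
qed

section \<open>Sums over odd positions and concatenation\<close>

fun odd_position_sum :: "int list \<Rightarrow> int" where
  "odd_position_sum [] = 0"
| "odd_position_sum [c] = c"
| "odd_position_sum (c # b # cs) = c + odd_position_sum cs"

text \<open>Positions count from 1 and indices from 0, so odd positions are even indices.\<close>

lemma odd_position_sum_nth: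
  "odd_position_sum B = (\<Sum>i | i < length B \<and> even i. B ! i)"
proof (induction B rule: odd_position_sum.induct)
  case (2 c)
  have "{i. i = 0 \<and> even i} = {0 :: nat}" by auto
  then show ?case by simp
next
  case (3 c b cs)
  have "{i. i < length (c # b # cs) \<and> even i} = insert 0 ((\<lambda>i. i + 2) ` {i. i < length cs \<and> even i})"
  proof (rule set_eqI)
    fix i show "i \<in> {i. i < length (c # b # cs) \<and> even i} \<longleftrightarrow>
      i \<in> insert 0 ((\<lambda>i. i + 2) ` {i. i < length cs \<and> even i})"
    proof (cases "i < 2")
      case True
      then show ?thesis by (cases i) auto
    next
      case False
      then obtain j where "i = j + 2" by (metis add.commute le_Suc_ex not_less)
      then show ?thesis by auto
    qed
  qed
  moreover have "inj_on (\<lambda>i. i + 2) {i. i < length cs \<and> even i}" by (rule inj_onI) simp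
  moreover have "0 \<notin> (\<lambda>i. i + 2) ` {i. i < length cs \<and> even i}" by auto
  ultimately show ?case using 3 by (simp add: sum.reindex del: add_2_eq_Suc')
qed simp

text \<open>Induction along the block. The step lemmas carry mixed parity through to
  \<open>cs\<close>, so the chain for \<open>cs\<close> need only be supplied under that condition.
  The increment of \<open>d\<close> is offset by the \<open>- 1\<close> in
  \<open>(c - 1) / 2\<close>.\<close>

lemma block_chain_append:
  assumes "positive_block B" and "cs = [] \<and> s = 0 \<or> cs \<noteq> [] \<and> (\<forall>c\<in>set cs. c > 0)"
    and "mixed_parity (cf_value (B @ cs))"
    and "cs \<noteq> [] \<Longrightarrow> mixed_parity (cf_value cs) \<Longrightarrow> block_chain cs s"
  shows "block_chain (B @ cs) (of_int (odd_position_sum B) / 2 + s)"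
  using assms(1,3)
proof induction
  case (even c)
  show ?case
  proof (cases "cs = []")
    case True
    then show ?thesis using even.hyps assms(2) by (auto intro: block_chain.last)
  next
    case False
    have "mixed_parity (cf_value cs)"
      using mixed_parity_even_step[of c "cf_value cs"] even cf_value_pos[OF False] assms(2) False
      by (auto simp: cf_value_Cons)
    then show ?thesis using even.hyps assms(2,4) False by (auto intro!: block_chain.even)
  qed
next
  case (odd c b d B)
  have "\<forall>c\<in>set B. c > 0" using positive_blockD[OF odd.hyps(5)] by (cases B) auto
  then have pos: "cf_value (d # B @ cs) > 0" using odd.hyps assms(2) by (intro cf_value_pos) auto
  have "mixed_parity (cf_value (d # B @ cs) + 1)"
    using mixed_parity_odd_step[of c b "cf_value (d # B @ cs)"] odd.prems odd.hyps pos
    by (simp add: cf_value_Cons)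
  then have "block_chain ((d + 1) # B @ cs) (of_int (odd_position_sum ((d + 1) # B)) / 2 + s)"
    using odd.IH by (simp add: cf_value_Cons add_ac)
  then have "block_chain (c # b # d # B @ cs)
      ((of_int c - 1) / 2 + (of_int (odd_position_sum ((d + 1) # B)) / 2 + s))"
    using odd.hyps by (intro block_chain.odd) auto
  moreover have "odd_position_sum (c # b # d # B) = c - 1 + odd_position_sum ((d + 1) # B)"
    by (cases B) auto
  then have "of_int (odd_position_sum (c # b # d # B)) / 2 + s =
      (of_int c - 1) / 2 + (of_int (odd_position_sum ((d + 1) # B)) / 2 + s)"
    by (simp only: of_int_add of_int_diff) (simp add: add_divide_distrib diff_divide_distrib)
  ultimately show ?case by (simp only: append_Cons)
qed

section \<open>Decompositions given by indices\<close>

lemma block_start_0 [simp]: "block_start Bs 0 = 0"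
  by (simp add: block_start_def)

lemma block_start_Cons_Suc [simp]: "block_start (B # Bs) (Suc j) = length B + block_start Bs j"
  by (simp add: block_start_def)

text \<open>Besides its own entries, a block sees only the absence of zeros and the last index of
  the list. For the latter \<open>cs\<close> must be nonempty, as \<open>length cs - 1\<close> is
  truncated.\<close>

lemma primitive_block_append:
  assumes "0 \<notin> set cs" and "0 \<notin> set (tl (B @ cs))" and "cs \<noteq> []"
  shows "primitive_block (B @ cs) (length B + m) k \<longleftrightarrow> primitive_block cs m k"
proof -
  have "0 \<notin> set (tl cs)" using assms(1) by (cases cs) auto
  moreover have "(!) (B @ cs) ` {length B + m..length B + m + 2 * k} = (!) cs ` {m..m + 2 * k}"
  proof -
    have "{length B + m..length B + m + 2 * k} = (+) (length B) ` {m..m + 2 * k}"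
      by (simp add: add.assoc)
    then show ?thesis by (simp only: image_image nth_append_length_plus)
  qed
  moreover have "length B + m = length (B @ cs) - 1 \<longleftrightarrow> m = length cs - 1"
    using assms(3) by (cases cs) auto
  ultimately show ?thesis using assms(2) unfolding primitive_block_def
    by (simp only: nth_append_length_plus add.assoc) simp
qed

lemma primitive_block_decomposition_Cons:
  assumes "0 \<notin> set (concat Bs)" and "0 \<notin> set (tl (B @ concat Bs))"
  shows "primitive_block_decomposition (B @ concat Bs) (B # Bs) \<longleftrightarrow>
    (\<exists>k. length B = 2 * k + 1 \<and> primitive_block (B @ concat Bs) 0 k) \<and>
    primitive_block_decomposition (concat Bs) Bs"
proof -
  have "(\<exists>k. length (Bs ! j) = 2 * k + 1 \<and>
      primitive_block (B @ concat Bs) (length B + block_start Bs j) k) \<longleftrightarrow>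
    (\<exists>k. length (Bs ! j) = 2 * k + 1 \<and> primitive_block (concat Bs) (block_start Bs j) k)"
    if "j < length Bs" for j
  proof (cases "concat Bs = []")
    case True
    \<comment> \<open>An empty block has even length, so both sides are false.\<close>
    then have "Bs ! j = []" using that by simp
    then show ?thesis by simp
  next
    case False
    then show ?thesis using primitive_block_append[OF assms(1,2)] by simp
  qed
  then show ?thesis
    unfolding primitive_block_decomposition_def by (simp add: All_less_Suc2)
qed

text \<open>Links the indexed notion to the recursive one. The second alternative is the final
  single entry, which may be odd.\<close>

lemma primitive_block_0_iff:
  assumes "length B = 2 * k + 1" and "\<forall>c\<in>set (tl (B @ cs)). c > 0" and "0 \<le> hd B"
  shows "primitive_block (B @ cs) 0 k \<longleftrightarrow> positive_block B \<or> cs = [] \<and> k = 0"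
proof -
  have nz: "0 \<notin> set (tl (B @ cs))" using assms(2) by auto
  have nth: "(B @ cs) ! i = B ! i" if "i \<le> 2 * k" for i
    using that assms(1) by (simp add: nth_append)
  have hd: "hd B = B ! 0" using assms(1) by (intro hd_conv_nth) auto
  have "(!) (B @ cs) ` {0..0 + 2 * k} = (!) B ` {0..2 * k}" using nth by simp
  also have "{0..2 * k} = {..<length B}" using assms(1) by auto
  also have "(!) B ` {..<length B} = set B" by (auto simp: set_conv_nth)
  finally have im: "(!) (B @ cs) ` {0..0 + 2 * k} = set B" .
  have ss: "same_sign (set B) \<longleftrightarrow> (\<forall>c\<in>set B. c > 0)"
    using assms(1,3) by (cases B) (auto simp: same_sign_def)
  have len: "0 = length (B @ cs) - 1 \<longleftrightarrow> cs = [] \<and> k = 0" using assms(1) by auto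
  have ev: "(\<forall>i\<in>{1..k - 1}. even ((B @ cs) ! (0 + 2 * i))) \<longleftrightarrow> (\<forall>i\<in>{1..k - 1}. even (B ! (2 * i)))"
    using nth by (intro ball_cong) auto
  have prim: "primitive_block (B @ cs) 0 k \<longleftrightarrow> k = 0 \<and> even (B ! 0) \<or>
      k \<ge> 1 \<and> (\<forall>c\<in>set B. c > 0) \<and> odd (B ! 0) \<and> odd (B ! (2 * k)) \<and>
      (\<forall>i\<in>{1..k - 1}. even (B ! (2 * i))) \<or> cs = [] \<and> k = 0"
    unfolding primitive_block_def im ss ev using nz nth[of 0] nth[of "2 * k"] assms(1) len by auto
  show ?thesis
  proof (cases "k = 0")
    case True
    then obtain c where c: "B = [c]" using assms(1) by (cases B) auto
    then have "positive_block B \<longleftrightarrow> even c"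
      using assms(3) by (auto elim: positive_block.cases intro: positive_block.even)
    then show ?thesis using prim True c by simp
  next
    case False
    then obtain j where k: "k = Suc j" by (cases k) auto
    show ?thesis
    proof
      assume "primitive_block (B @ cs) 0 k"
      then show "positive_block B \<or> cs = [] \<and> k = 0"
        using prim positive_blockI[of B j] assms(1) k by auto
    next
      assume "positive_block B \<or> cs = [] \<and> k = 0"
      then obtain l where "length B = 2 * l + 1" "l = 0 \<and> even (B ! 0) \<or>
          l \<ge> 1 \<and> (\<forall>c\<in>set B. c > 0) \<and> odd (B ! 0) \<and> odd (B ! (2 * l)) \<and>
          (\<forall>i\<in>{1..l - 1}. even (B ! (2 * i)))"
        using positive_blockD[of B] False by blast
      moreover from this(1) have "l = k" using assms(1) by simp
      ultimately show "primitive_block (B @ cs) 0 k" using prim by blast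
    qed
  qed
qed

lemma in_odd_position_Cons:
  "in_odd_position (B # Bs) i \<longleftrightarrow> (if i < length B then even i else in_odd_position Bs (i - length B))"
  unfolding in_odd_position_def by (auto simp: Ex_less_Suc2)

definition odd_position_abs_sum :: "int list \<Rightarrow> int list list \<Rightarrow> rat" where
  "odd_position_abs_sum cs Bs = (\<Sum>i | i < length cs \<and> in_odd_position Bs i. of_int \<bar>cs ! i\<bar> / 2)"

lemma odd_position_abs_sum_Cons:
  "odd_position_abs_sum (B @ cs) (B # Bs) =
    of_int (odd_position_sum (map abs B)) / 2 + odd_position_abs_sum cs Bs"
proof -
  let ?I = "{i. i < length B \<and> even i}" and ?J = "{i. i < length cs \<and> in_odd_position Bs i}"
  have "{i. i < length (B @ cs) \<and> in_odd_position (B # Bs) i} = ?I \<union> (+) (length B) ` ?J" (is "?A = ?B")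
  proof (rule set_eqI)
    fix i show "i \<in> ?A \<longleftrightarrow> i \<in> ?B"
      by (cases "i < length B") (auto simp: in_odd_position_Cons image_iff intro!: exI[of _ "i - length B"])
  qed
  then have "odd_position_abs_sum (B @ cs) (B # Bs) =
      (\<Sum>i\<in>?I \<union> (+) (length B) ` ?J. of_int \<bar>(B @ cs) ! i\<bar> / 2)"
    by (simp only: odd_position_abs_sum_def)
  also have "\<dots> = (\<Sum>i\<in>?I. of_int \<bar>(B @ cs) ! i\<bar> / 2) +
      (\<Sum>i\<in>(+) (length B) ` ?J. of_int \<bar>(B @ cs) ! i\<bar> / 2)"
    by (rule sum.union_disjoint) auto
  also have "(\<Sum>i\<in>?I. of_int \<bar>(B @ cs) ! i\<bar> / 2 :: rat) = of_int (odd_position_sum (map abs B)) / 2"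
    by (simp add: odd_position_sum_nth nth_append sum_divide_distrib)
  also have "(\<Sum>i\<in>(+) (length B) ` ?J. of_int \<bar>(B @ cs) ! i\<bar> / 2) = odd_position_abs_sum cs Bs"
    by (simp add: sum.reindex odd_position_abs_sum_def)
  finally show ?thesis .
qed

section \<open>Nonnegative expansions as block chains\<close>

definition nonneg_form :: "int list \<Rightarrow> bool" where
  "nonneg_form cs \<longleftrightarrow> cs \<noteq> [] \<and> (\<forall>c\<in>set (tl cs). c > 0) \<and> hd cs \<ge> 0"

text \<open>Blocks are prepended one by one with \<open>block_chain_append\<close>. Since
  \<open>Bs\<close> is arbitrary, the sum can later be compared across decompositions.\<close>

lemma block_chain_if_decomposition:
  assumes "nonneg_form cs" and "mixed_parity (cf_value cs)" and "primitive_block_decomposition cs Bs"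
  shows "block_chain cs (odd_position_abs_sum cs Bs)"
  using assms
proof (induction Bs arbitrary: cs)
  case Nil
  then show ?case by (simp add: primitive_block_decomposition_def nonneg_form_def)
next
  case (Cons B Bs)
  let ?cs = "concat Bs"
  have cs: "cs = B @ ?cs" using Cons.prems(3) by (simp add: primitive_block_decomposition_def)
  have "\<exists>k. length B = 2 * k + 1"
    using Cons.prems(3) unfolding primitive_block_decomposition_def by force
  then have Bne: "B \<noteq> []" by auto
  then have pos: "\<forall>c\<in>set ?cs. c > 0" "\<forall>c\<in>set (tl (B @ ?cs)). c > 0" and hd: "0 \<le> hd B"
    using Cons.prems(1) by (auto simp: cs nonneg_form_def)
  have "0 \<notin> set ?cs" "0 \<notin> set (tl (B @ ?cs))" using pos by blast+
  then obtain k where k: "length B = 2 * k + 1" "primitive_block cs 0 k"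
    and dec: "primitive_block_decomposition ?cs Bs"
    using Cons.prems(3) primitive_block_decomposition_Cons[of Bs B] cs by metis
  \<comment> \<open>Otherwise \<open>B\<close> is a final single odd entry and \<open>cs\<close> has
    an odd integer as its value, against mixed parity.\<close>
  have "positive_block B"
  proof (rule ccontr)
    assume *: "\<not> positive_block B"
    then have "?cs = []" "k = 0"
      using primitive_block_0_iff[OF k(1) pos(2) hd] k(2) cs by auto
    moreover then obtain c where c: "B = [c]" using k by (cases B) auto
    moreover have "odd c" using * hd c positive_block.even by auto
    ultimately show False using not_mixed_parity_odd[of c] Cons.prems(2) cs
      by (simp only: append_Cons append_Nil cf_value.simps) simp
  qed
  moreover have abs_B: "map abs B = B"
    using pos(2) hd Bne by (cases B) (auto intro!: map_idI abs_of_pos)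
  moreover have "block_chain ?cs (odd_position_abs_sum ?cs Bs)"
    if "?cs \<noteq> []" "mixed_parity (cf_value ?cs)"
  proof (rule Cons.IH)
    show "nonneg_form ?cs" using pos(1) that by (cases ?cs) (auto simp: nonneg_form_def)
  qed (use that dec in auto)
  moreover have "odd_position_abs_sum ?cs Bs = 0" if "?cs = []"
    unfolding that odd_position_abs_sum_def by simp
  ultimately have "block_chain (B @ ?cs) (of_int (odd_position_sum B) / 2 + odd_position_abs_sum ?cs Bs)"
    using pos(1) Cons.prems(2) cs by (intro block_chain_append) auto
  then show ?case
    using odd_position_abs_sum_Cons[of B ?cs Bs] abs_B cs by simp
qed

lemma block_chain_nonneg_form: "block_chain cs s \<Longrightarrow> nonneg_form cs"
proof (induction rule: block_chain.induct)
  case (even c cs s)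
  then show ?case by (cases cs) (auto simp: nonneg_form_def)
qed (auto simp: nonneg_form_def)

text \<open>In the odd case the block that starts with \<open>d + 1\<close> is extended: its first
  entry is lowered to \<open>d\<close>, and \<open>c\<close> and \<open>b\<close> are put in
  front.\<close>

lemma block_chain_concat:
  assumes "block_chain cs s"
  shows "\<exists>Bs. concat Bs = cs \<and> (\<forall>B\<in>set Bs. positive_block B)"
  using assms
proof induction
  case (last c)
  then show ?case by (intro exI[of _ "[[c]]"]) (auto intro: positive_block.even)
next
  case (even c cs s)
  then obtain Bs where "concat Bs = cs" "\<forall>B\<in>set Bs. positive_block B" by blast
  then show ?case using even.hyps by (intro exI[of _ "[c] # Bs"]) (auto intro: positive_block.even)
next
  case (odd c b d cs s)
  then obtain Bs where Bs: "concat Bs = (d + 1) # cs" "\<forall>B\<in>set Bs. positive_block B" by blast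
  then obtain B Bs' where B: "Bs = B # Bs'" by (cases Bs) auto
  then have "B \<noteq> []" using Bs positive_blockD[of B] by auto
  then obtain C where "B = (d + 1) # C" using Bs B by (cases B) auto
  then show ?case using odd.hyps Bs B
    by (intro exI[of _ "(c # b # d # C) # Bs'"]) (auto intro: positive_block.odd)
qed

lemma primitive_block_decomposition_if_positive_blocks:
  assumes "\<forall>B\<in>set Bs. positive_block B" and "concat Bs = [] \<or> nonneg_form (concat Bs)"
  shows "primitive_block_decomposition (concat Bs) Bs"
  using assms
proof (induction Bs)
  case Nil
  then show ?case by (simp add: primitive_block_decomposition_def)
next
  case (Cons B Bs)
  let ?cs = "concat Bs"
  have B: "positive_block B" using Cons.prems by simp
  then obtain k where k: "length B = 2 * k + 1" using positive_blockD by blast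
  then have Bne: "B \<noteq> []" by auto
  then have pos: "\<forall>c\<in>set ?cs. c > 0" "\<forall>c\<in>set (tl (B @ ?cs)). c > 0" and hd: "0 \<le> hd B"
    using Cons.prems(2) by (auto simp: nonneg_form_def)
  have "primitive_block (B @ ?cs) 0 k" using primitive_block_0_iff[OF k pos(2) hd] B by simp
  moreover have "primitive_block_decomposition ?cs Bs"
  proof (rule Cons.IH)
    show "?cs = [] \<or> nonneg_form ?cs" using pos(1) by (cases ?cs) (auto simp: nonneg_form_def)
  qed (use Cons.prems in auto)
  moreover have "0 \<notin> set ?cs" "0 \<notin> set (tl (B @ ?cs))" using pos by blast+
  ultimately show ?case using k by (auto simp: primitive_block_decomposition_Cons)
qed

section \<open>Change of sign\<close>

lemma nonalternating_iff:
  "nonalternating cs \<longleftrightarrow> nonneg_form cs \<or> nonneg_form (map uminus cs)"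
  by (cases cs) (auto simp: nonalternating_def nonneg_form_def)

lemma nonneg_form_value:
  assumes "nonneg_form cs"
  shows "cf_value cs \<ge> 0" and "cf_value cs = 0 \<Longrightarrow> cs = [0]"
proof -
  obtain c ds where cs: "cs = c # ds" "c \<ge> 0" "\<forall>d\<in>set ds. d > 0"
    using assms by (cases cs) (auto simp: nonneg_form_def)
  have ds: "1 / cf_value ds > 0" if "ds \<noteq> []" using cf_value_pos[OF that] cs by simp
  show "cf_value cs \<ge> 0" using ds cs by (cases "ds = []") (auto simp: cf_value_Cons)
  show "cs = [0]" if "cf_value cs = 0"
  proof (cases "ds = []")
    case True
    then show ?thesis using cs that by simp
  next
    case False
    have "of_int c \<ge> (0 :: rat)" using cs by simp
    then have "cf_value cs > 0" using ds[OF False] unfolding cs(1) cf_value_Cons by linarith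
    then show ?thesis using that by simp
  qed
qed

text \<open>The two sign forms share only the value 0, and there both give
  \<open>[0]\<close>.\<close>

lemma nonalternating_nonneg_form:
  assumes "nonalternating cs" and "cf_value cs \<ge> 0"
  shows "nonneg_form cs"
proof (rule ccontr)
  assume *: "\<not> nonneg_form cs"
  then have n: "nonneg_form (map uminus cs)" using assms(1) nonalternating_iff by blast
  have "cf_value (map uminus cs) = 0"
    using nonneg_form_value(1)[OF n] assms(2) by (simp add: cf_value_map_uminus)
  then have "map uminus cs = [0]" using nonneg_form_value(2)[OF n] by blast
  then have "cs = [0]" by auto
  then show False using * by (simp add: nonneg_form_def)
qed

lemma primitive_block_map_uminus:
  "primitive_block (map uminus cs) m k \<longleftrightarrow> primitive_block cs m k"
proof (cases "m + 2 * k < length cs")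
  case True
  then have "(!) (map uminus cs) ` {m..m + 2 * k} = uminus ` (!) cs ` {m..m + 2 * k}"
    by (auto simp: image_image)
  moreover have "same_sign (uminus ` A) \<longleftrightarrow> same_sign A" for A
    by (auto simp: same_sign_def)
  moreover have "0 \<notin> set (tl (map uminus cs)) \<longleftrightarrow> 0 \<notin> set (tl cs)"
    by (auto simp: map_tl[symmetric])
  moreover have "(\<forall>i\<in>{1..k - 1}. even (map uminus cs ! (m + 2 * i))) \<longleftrightarrow>
      (\<forall>i\<in>{1..k - 1}. even (cs ! (m + 2 * i)))"
    using True by (intro ball_cong) auto
  ultimately show ?thesis using True unfolding primitive_block_def by auto
qed (simp add: primitive_block_def)

lemma block_start_map: "block_start (map (map f) Bs) j = block_start Bs j"
  by (simp add: block_start_def take_map map_concat[symmetric])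

lemma in_odd_position_map: "in_odd_position (map (map f) Bs) i \<longleftrightarrow> in_odd_position Bs i"
  by (auto simp: in_odd_position_def block_start_map)

lemma primitive_block_decomposition_map_uminus:
  "primitive_block_decomposition cs Bs \<Longrightarrow>
    primitive_block_decomposition (map uminus cs) (map (map uminus) Bs)"
  by (auto simp: primitive_block_decomposition_def block_start_map primitive_block_map_uminus
      map_concat[symmetric])

lemma primitive_block_expansion_uminus:
  "primitive_block_expansion x cs \<Longrightarrow> primitive_block_expansion (- x) (map uminus cs)"
  unfolding primitive_block_expansion_def nonalternating_iff
  by (auto simp: cf_value_map_uminus comp_def dest: primitive_block_decomposition_map_uminus)

lemma odd_position_abs_sum_map_uminus:
  "odd_position_abs_sum (map uminus cs) (map (map uminus) Bs) = odd_position_abs_sum cs Bs"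
  by (simp add: odd_position_abs_sum_def in_odd_position_map)

section \<open>Existence, uniqueness and the index formula\<close>

lemma block_expansion_of_nonneg:
  fixes p q :: int
  assumes "p \<ge> 0" and "q > 0" and "odd (p + q)"
  defines "x \<equiv> of_int p / of_int q"
  shows "\<exists>cs. primitive_block_expansion x cs \<and> (\<forall>cs'. primitive_block_expansion x cs' \<longrightarrow> cs' = cs)"
    and "\<exists>ds. even_expansion x ds \<and>
      (\<forall>cs Bs. primitive_block_expansion x cs \<longrightarrow> primitive_block_decomposition cs Bs \<longrightarrow>
        of_int (cm_sum ds) = odd_position_abs_sum cs Bs)"
proof -
  have x: "mixed_parity x" "x \<ge> 0"
  proof -
    show "mixed_parity x" unfolding mixed_parity_def x_def
      using assms(2,3) by (intro exI[of _ p] exI[of _ q]) auto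
    show "x \<ge> 0" using assms(1,2) by (simp add: x_def)
  qed
  obtain cs s where cs: "block_chain cs s" "cf_value cs = x"
    using block_chain_exists[of p q] assms by blast
  obtain Bs where Bs: "concat Bs = cs" "\<forall>B\<in>set Bs. positive_block B"
    using block_chain_concat[OF cs(1)] by blast
  have "nonneg_form cs" using cs by (blast intro: block_chain_nonneg_form)
  then have pbe: "primitive_block_expansion x cs"
    using cs(2) Bs(1) primitive_block_decomposition_if_positive_blocks[OF Bs(2)]
    by (auto simp: primitive_block_expansion_def nonalternating_iff)
  have chain: "block_chain cs' (odd_position_abs_sum cs' Bs')"
    if "primitive_block_expansion x cs'" "primitive_block_decomposition cs' Bs'" for cs' Bs'
    using that x nonalternating_nonneg_form[of cs']
    by (intro block_chain_if_decomposition) (auto simp: primitive_block_expansion_def)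
  have unique: "cs' = cs" if expansion: "primitive_block_expansion x cs'" for cs'
  proof -
    obtain Bs' where "primitive_block_decomposition cs' Bs'" and "cf_value cs' = x"
      using expansion unfolding primitive_block_expansion_def by blast
    then show ?thesis using block_chain_unique[OF cs(1) chain[OF expansion]] cs(2) by simp
  qed
  show "\<exists>cs. primitive_block_expansion x cs \<and> (\<forall>cs'. primitive_block_expansion x cs' \<longrightarrow> cs' = cs)"
    using pbe unique by blast
  show "\<exists>ds. even_expansion x ds \<and>
      (\<forall>cs Bs. primitive_block_expansion x cs \<longrightarrow> primitive_block_decomposition cs Bs \<longrightarrow>
        of_int (cm_sum ds) = odd_position_abs_sum cs Bs)"
  proof -
    obtain ds where ds: "even_expansion x ds" "of_int (cm_sum ds) = s"
      using block_chain_even_expansion[OF cs(1)] cs(2) by blast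
    have "of_int (cm_sum ds) = odd_position_abs_sum cs' Bs'"
      if expansion: "primitive_block_expansion x cs'" "primitive_block_decomposition cs' Bs'"
      for cs' Bs'
    proof -
      have "cs' = cs" using unique expansion by blast
      \<comment> \<open>Chains on one list might carry different sums; each sum comes from an even
        expansion of \<open>x\<close>, and these have the same index.\<close>
      obtain es where "even_expansion x es" "of_int (cm_sum es) = odd_position_abs_sum cs' Bs'"
        using block_chain_even_expansion[OF chain[OF expansion]] \<open>cs' = cs\<close> cs(2) by blast
      then show ?thesis
        using cromwell_murasugi_index_eq[of x ds] cromwell_murasugi_index_eq[of x es] ds by simp
    qed
    then show ?thesis using ds by blast
  qed
qed

theorem theorem5p3:
  fixes p q :: int
  assumes "q \<noteq> 0" and "coprime p q" and "even (p * q)"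
  shows "(\<exists>!cs. primitive_block_expansion (of_int p / of_int q) cs) \<and>
    (\<forall>cs Bs. primitive_block_expansion (of_int p / of_int q) cs \<longrightarrow>
       primitive_block_decomposition cs Bs \<longrightarrow>
       rat_of_int (cromwell_murasugi_index (of_int p / of_int q)) =
         1 + (\<Sum>i\<in>{i. i < length cs \<and> in_odd_position Bs i}. of_int \<bar>cs ! i\<bar> / 2))"
proof -
  define x :: rat where "x = of_int p / of_int q"
  \<comment> \<open>Coprimality excludes that both are even, the even product that both are
    odd.\<close>
  have pq: "odd (p + q)" using assms by (auto dest: coprime_common_divisor[where c = 2])
  \<comment> \<open>As \<open>q\<close> may be negative, both absolute values are taken; this keeps
    parities.\<close>
  have "\<bar>x\<bar> = of_int \<bar>p\<bar> / of_int \<bar>q\<bar>" "\<bar>p\<bar> \<ge> 0" "\<bar>q\<bar> > 0" "odd (\<bar>p\<bar> + \<bar>q\<bar>)"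
    using assms(1) pq by (simp_all add: x_def)
  note nonneg = block_expansion_of_nonneg[OF this(2-4), folded this(1)]
  from nonneg obtain cs ds where abs_x: "primitive_block_expansion \<bar>x\<bar> cs"
      "\<And>cs'. primitive_block_expansion \<bar>x\<bar> cs' \<Longrightarrow> cs' = cs" "even_expansion \<bar>x\<bar> ds"
      "\<And>cs Bs. primitive_block_expansion \<bar>x\<bar> cs \<Longrightarrow> primitive_block_decomposition cs Bs \<Longrightarrow>
        of_int (cm_sum ds) = odd_position_abs_sum cs Bs"
    by blast
  have "(\<exists>!cs. primitive_block_expansion x cs) \<and>
    (\<forall>cs Bs. primitive_block_expansion x cs \<longrightarrow> primitive_block_decomposition cs Bs \<longrightarrow>
       rat_of_int (cromwell_murasugi_index x) = 1 + odd_position_abs_sum cs Bs)"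
  proof (cases "x \<ge> 0")
    case True
    then show ?thesis using abs_x cromwell_murasugi_index_eq[of x ds] by auto
  next
    case False
    then have neg: "\<bar>x\<bar> = - x" by simp
    have "primitive_block_expansion x (map uminus cs)"
      using primitive_block_expansion_uminus[OF abs_x(1)] neg by simp
    moreover have "cs' = map uminus cs" if "primitive_block_expansion x cs'" for cs'
    proof -
      have "map uminus cs' = cs"
        using abs_x(2) primitive_block_expansion_uminus[OF that] neg by simp
      then show ?thesis by (auto simp: comp_def)
    qed
    moreover have "cromwell_murasugi_index x = cm_sum ds + 1"
      using cromwell_murasugi_index_eq[OF even_expansion_uminus[OF abs_x(3)]] neg
      by (simp add: cm_sum_map_uminus)
    moreover have "of_int (cm_sum ds) = odd_position_abs_sum cs' Bs"
      if "primitive_block_expansion x cs'" "primitive_block_decomposition cs' Bs" for cs' Bs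
      using abs_x(4)[of "map uminus cs'" "map (map uminus) Bs"] neg that
      by (simp add: primitive_block_expansion_uminus primitive_block_decomposition_map_uminus
          odd_position_abs_sum_map_uminus)
    ultimately show ?thesis by auto
  qed
  then show ?thesis unfolding x_def odd_position_abs_sum_def .
qed

end
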